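(* Let $n\ge 2$ and let $F_n$ be the free group on $x_1,\dots,x_n$. The map $\mu_n:T_n\to\operatorname{Aut}(F_n)$ defined on the generators $s_i$, $1\le i\le n-1$, of $T_n$ by $$\mu_n(s_i):\ \begin{cases} x_i\mapsto x_ix_{i+1},\\ x_{i+1}\mapsto x_{i+1}^{-1},\\ x_j\mapsto x_j, & j\ne i,i+1,\end{cases}$$ is a representation of $T_n$ (that is, these assignments define automorphisms of $F_n$ and extend to a group homomorphism $T_n\to\operatorname{Aut}(F_n)$). Moreover, $\mu_n$ is faithful (injective) if and only if $n=2$ or $n=3$.
   Context: For an integer $n\ge 2$, the twin group $T_n$ is the group generated by $s_1,\dots,s_{n-1}$ with defining relations $s_i^2=1$ for all $i$, and $s_is_j=s_js_i$ whenever $|i-j|\ge 2$. *)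

theory Defs
  imports "HOL-Algebra.Coset" "HOL-Algebra.Bij"
begin

section \<open>Free groups\<close>

text \<open>
  The free group on \<open>X\<close> is realised on freely reduced words. The letter \<open>(x, True)\<close> stands for
  \<open>x\<close> and \<open>(x, False)\<close> for its inverse.
\<close>

type_synonym 'a word = "('a \<times> bool) list"

definition inv_letter :: "'a \<times> bool \<Rightarrow> 'a \<times> bool" where
  "inv_letter a = (fst a, \<not> snd a)"

definition reduced :: "'a word \<Rightarrow> bool" where
  "reduced w \<longleftrightarrow> successively (\<lambda>a b. b \<noteq> inv_letter a) w"

fun cancel_cons :: "'a \<times> bool \<Rightarrow> 'a word \<Rightarrow> 'a word" where
  "cancel_cons a [] = [a]"
| "cancel_cons a (b # w) = (if b = inv_letter a then w else a # b # w)"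

text \<open>For reduced \<open>u\<close> and \<open>v\<close> the product below is the reduced form of \<open>u @ v\<close>.\<close>

definition free_group :: "'a set \<Rightarrow> 'a word monoid" where
  "free_group X =
     \<lparr>carrier = {w. fst ` set w \<subseteq> X \<and> reduced w},
      monoid.mult = (\<lambda>u v. foldr cancel_cons u v),
      one = []\<rparr>"

definition free_gen :: "'a \<Rightarrow> 'a word" where
  "free_gen x = [(x, True)]"

lemma inv_letter_inv_letter [simp]: "inv_letter (inv_letter a) = a"
  by (simp add: inv_letter_def)

lemma fst_inv_letter [simp]: "fst (inv_letter a) = fst a"
  by (simp add: inv_letter_def)

lemma inv_letter_neq [simp]: "inv_letter a \<noteq> a" "a \<noteq> inv_letter a"
  by (auto simp: inv_letter_def prod_eq_iff)

lemma reduced_Nil [simp]: "reduced []"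
  by (simp add: reduced_def)

lemma reduced_Cons: "reduced (a # w) \<longleftrightarrow> (w = [] \<or> hd w \<noteq> inv_letter a) \<and> reduced w"
  by (cases w) (auto simp: reduced_def)

lemma reduced_cancel_cons: "reduced w \<Longrightarrow> reduced (cancel_cons a w)"
  by (cases w) (auto simp: reduced_Cons)

lemma cancel_cons_inv_letter:
  assumes "reduced w"
  shows "cancel_cons (inv_letter a) (cancel_cons a w) = w"
proof (cases w)
  case (Cons b v)
  with assms show ?thesis by (cases v) (auto simp: reduced_Cons)
qed simp

lemma reduced_foldr: "reduced v \<Longrightarrow> reduced (foldr cancel_cons u v)"
  by (induction u) (auto simp: reduced_cancel_cons)

lemma set_cancel_cons: "set (cancel_cons a w) \<subseteq> insert a (set w)"
  by (cases w) auto

lemma set_foldr: "set (foldr cancel_cons u v) \<subseteq> set u \<union> set v"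
proof (induction u)
  case (Cons a u)
  then show ?case using set_cancel_cons[of a "foldr cancel_cons u v"] by auto
qed simp

lemma foldr_cancel_cons:
  assumes "reduced w"
  shows "foldr cancel_cons (cancel_cons a u) w = cancel_cons a (foldr cancel_cons u w)"
  using cancel_cons_inv_letter[OF reduced_foldr[OF assms], of "inv_letter a"]
  by (cases u) auto

lemma foldr_assoc:
  "reduced w \<Longrightarrow>
    foldr cancel_cons (foldr cancel_cons u v) w = foldr cancel_cons u (foldr cancel_cons v w)"
  by (induction u) (auto simp: foldr_cancel_cons)

lemma foldr_reduced: "reduced u \<Longrightarrow> foldr cancel_cons u [] = u"
proof (induction u)
  case (Cons a u)
  then show ?case by (cases u) (auto simp: reduced_Cons)
qed simp

lemma foldr_inverse:
  "reduced w \<Longrightarrow> foldr cancel_cons (rev (map inv_letter u)) (foldr cancel_cons u w) = w"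
proof (induction u)
  case (Cons a u)
  then show ?case by (simp add: cancel_cons_inv_letter reduced_foldr)
qed simp

theorem group_free_group: "group (free_group X)"
proof (rule groupI)
  fix u v assume "u \<in> carrier (free_group X)" "v \<in> carrier (free_group X)"
  then show "u \<otimes>\<^bsub>free_group X\<^esub> v \<in> carrier (free_group X)"
    using set_foldr[of u v] by (fastforce simp: free_group_def reduced_foldr)
next
  fix u assume u: "u \<in> carrier (free_group X)"
  define v where "v = foldr cancel_cons (rev (map inv_letter u)) []"
  have "v \<in> carrier (free_group X)"
    using set_foldr[of "rev (map inv_letter u)" "[]"] u
    by (force simp: free_group_def reduced_foldr v_def)
  moreover have "v \<otimes>\<^bsub>free_group X\<^esub> u = \<one>\<^bsub>free_group X\<^esub>"
    using foldr_inverse[of "[]" u] u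
    by (simp add: free_group_def v_def foldr_assoc foldr_reduced)
  ultimately show "\<exists>v\<in>carrier (free_group X). v \<otimes>\<^bsub>free_group X\<^esub> u = \<one>\<^bsub>free_group X\<^esub>"
    by blast
qed (auto simp: free_group_def foldr_assoc)


section \<open>Groups given by generators and relators\<close>

definition normal_closure :: "('a, 'b) monoid_scheme \<Rightarrow> 'a set \<Rightarrow> 'a set" where
  "normal_closure G R = \<Inter> {N. N \<lhd> G \<and> R \<subseteq> N}"

definition presented_group :: "'a set \<Rightarrow> 'a word set \<Rightarrow> 'a word set monoid" where
  "presented_group X R = free_group X Mod normal_closure (free_group X) R"

definition presented_gen :: "'a set \<Rightarrow> 'a word set \<Rightarrow> 'a \<Rightarrow> 'a word set" where
  "presented_gen X R x = normal_closure (free_group X) R #>\<^bsub>free_group X\<^esub> free_gen x"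


section \<open>Twin groups\<close>

text \<open>A relation \<open>u = v\<close> is encoded by the relator \<open>u v\<^sup>-\<^sup>1\<close>.\<close>

definition twin_relators :: "nat \<Rightarrow> nat word set" where
  "twin_relators n =
     (let F = free_group {1..n - 1}; s = free_gen in
       {s i \<otimes>\<^bsub>F\<^esub> s i | i. i \<in> {1..n - 1}} \<union>
       {(s i \<otimes>\<^bsub>F\<^esub> s j) \<otimes>\<^bsub>F\<^esub> inv\<^bsub>F\<^esub> (s j \<otimes>\<^bsub>F\<^esub> s i) | i j.
          i \<in> {1..n - 1} \<and> j \<in> {1..n - 1} \<and> \<bar>int i - int j\<bar> \<ge> 2})"

definition twin_group :: "nat \<Rightarrow> nat word set monoid" where
  "twin_group n = presented_group {1..n - 1} (twin_relators n)"

definition twin_gen :: "nat \<Rightarrow> nat \<Rightarrow> nat word set" where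
  "twin_gen n i = presented_gen {1..n - 1} (twin_relators n) i"

text \<open>The values on the free generators prescribed for the image of the \<open>i\<close>-th twin generator.\<close>

definition mu_gen_image :: "nat \<Rightarrow> nat \<Rightarrow> nat \<Rightarrow> nat word" where
  "mu_gen_image n i j =
     (let F = free_group {1..n}; x = free_gen in
       if j = i then x i \<otimes>\<^bsub>F\<^esub> x (i + 1)
       else if j = i + 1 then inv\<^bsub>F\<^esub> (x (i + 1))
       else x j)"

text \<open>
  In \<open>AutoGroup\<close> the product \<open>f \<otimes> g\<close> is the composite \<open>f \<circ> g\<close>, and automorphisms are extensional
  functions on the carrier. A map \<open>\<mu>\<close> on the twin group is likewise taken to be extensional, so
  that equality of such maps means agreement on the twin group.
\<close>

definition is_mu :: "nat \<Rightarrow> (nat word set \<Rightarrow> nat word \<Rightarrow> nat word) \<Rightarrow> bool" where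
  "is_mu n \<mu> \<longleftrightarrow>
     \<mu> \<in> hom (twin_group n) (AutoGroup (free_group {1..n})) \<and>
     \<mu> \<in> extensional (carrier (twin_group n)) \<and>
     (\<forall>i\<in>{1..n - 1}. \<forall>j\<in>{1..n}. \<mu> (twin_gen n i) (free_gen j) = mu_gen_image n i j)"

end

theory Submission
  imports Defs "HOL-Combinatorics.Transposition"
begin

text \<open>
  Each \<open>\<mu>(s\<^sub>i)\<close> is an involution, and two of them with \<open>|i - j| \<ge> 2\<close> act on disjoint sets of
  generators, so the universal property of the presentation yields \<open>\<mu>\<close>.

  The group \<open>T\<^sub>3\<close> is infinite dihedral, with elements \<open>p\<^sup>k\<close> and \<open>p\<^sup>k s\<^sub>1\<close> for \<open>p = s\<^sub>1 s\<^sub>2\<close>. They are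
  told apart by the exponent sums of the image of \<open>x\<^sub>2\<close>, since \<open>p\<close> acts on the span of
  \<open>x\<^sub>2, x\<^sub>3\<close> in the abelianization as the negative of a nontrivial unipotent map.

  For \<open>n \<ge> 4\<close> put \<open>r = s\<^sub>2 s\<^sub>3 s\<^sub>2\<close>. The conjugates of \<open>s\<^sub>1\<close> by \<open>\<langle>s\<^sub>2, s\<^sub>3\<rangle>\<close> include involutions \<open>t\<^sub>k\<close> with
  \<open>x\<^sub>1 \<mapsto> x\<^sub>1 x\<^sub>2 x\<^sub>4\<^sup>k\<close>, \<open>x\<^sub>2 \<mapsto> x\<^sub>4\<^sup>-\<^sup>k x\<^sub>2\<^sup>-\<^sup>1 x\<^sub>4\<^sup>-\<^sup>k\<close> and all other generators fixed, where \<open>t\<^sub>0 = s\<^sub>1\<close>,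
  \<open>t\<^sub>1 = r s\<^sub>1 r\<close> and \<open>t\<^sub>-\<^sub>1 = s\<^sub>3 t\<^sub>1 s\<^sub>3\<close>. The product \<open>t\<^sub>k t\<^sub>l\<close> depends only on \<open>k - l\<close>. Hence
  \<open>t\<^sub>-\<^sub>1 t\<^sub>0 = t\<^sub>0 t\<^sub>1\<close>, which says that the images of \<open>s\<^sub>1 s\<^sub>3\<close> and \<open>r s\<^sub>1 r\<close> commute. In the symmetric
  group quotient of \<open>T\<^sub>n\<close> these two elements become \<open>(1 2)(3 4)\<close> and \<open>(1 4)\<close>, which do not commute.
\<close>

section \<open>Universal properties\<close>

text \<open>Evaluation is defined on all words, reduced or not, so that its compatibility with free
  reduction can be stated one cancellation at a time.\<close>

definition free_lift :: "('b, 'c) monoid_scheme \<Rightarrow> ('a \<Rightarrow> 'b) \<Rightarrow> 'a word \<Rightarrow> 'b" where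
  "free_lift H f w =
     foldr (\<lambda>a y. (if snd a then f (fst a) else inv\<^bsub>H\<^esub> f (fst a)) \<otimes>\<^bsub>H\<^esub> y) w \<one>\<^bsub>H\<^esub>"

text \<open>Together with \<open>m_assoc\<close> these rules let simp cancel inside right-nested
  products, which settles the word identities below.\<close>

lemma (in group) inv_mult_cancel_left [simp]:
  assumes "x \<in> carrier G" "y \<in> carrier G"
  shows "inv x \<otimes> (x \<otimes> y) = y" "x \<otimes> (inv x \<otimes> y) = y"
  using assms by (simp_all flip: m_assoc)

lemma free_gen_in_carrier [simp]: "x \<in> X \<Longrightarrow> free_gen x \<in> carrier (free_group X)"
  by (simp add: free_group_def free_gen_def reduced_Cons)

lemma inv_free_gen:
  assumes "x \<in> X"
  shows "inv\<^bsub>free_group X\<^esub> free_gen x = [(x, False)]"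
  using assms
  by (intro group.inv_equality[OF group_free_group])
    (auto simp: free_group_def free_gen_def reduced_Cons inv_letter_def)

lemma free_group_induct [consumes 1, case_names one gen inv_gen]:
  assumes "w \<in> carrier (free_group X)"
    and "P \<one>\<^bsub>free_group X\<^esub>"
    and "\<And>x w. \<lbrakk>x \<in> X; w \<in> carrier (free_group X); P w\<rbrakk> \<Longrightarrow> P (free_gen x \<otimes>\<^bsub>free_group X\<^esub> w)"
    and "\<And>x w. \<lbrakk>x \<in> X; w \<in> carrier (free_group X); P w\<rbrakk> \<Longrightarrow>
          P (inv\<^bsub>free_group X\<^esub> free_gen x \<otimes>\<^bsub>free_group X\<^esub> w)"
  shows "P w"
  using assms(1)
proof (induction w)
  case Nil
  then show ?case using assms(2) by (simp add: free_group_def)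
next
  case (Cons a w)
  obtain x b where a: "a = (x, b)" by fastforce
  have x: "x \<in> X" and w: "w \<in> carrier (free_group X)"
    using Cons.prems by (auto simp: free_group_def reduced_Cons a)
  \<comment> \<open>Since \<open>a # w\<close> is reduced, no cancellation occurs and the product is
    plain consing.\<close>
  have eq: "[a] \<otimes>\<^bsub>free_group X\<^esub> w = a # w"
    using Cons.prems by (cases w) (auto simp: free_group_def reduced_Cons)
  show ?case
  proof (cases b)
    case True
    then show ?thesis using assms(3)[OF x w Cons.IH[OF w]] eq by (simp add: free_gen_def a)
  next
    case False
    then show ?thesis using assms(4)[OF x w Cons.IH[OF w]] eq by (simp add: inv_free_gen[OF x] a)
  qed
qed

text \<open>Multiplication in the free group is iterated \<open>cancel_cons\<close>, so it suffices
  that a single cancellation leaves the value in \<open>H\<close> unchanged.\<close>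

lemma free_lift_hom:
  assumes "group H" and f: "f \<in> X \<rightarrow> carrier H"
  shows "free_lift H f \<in> hom (free_group X) H"
proof -
  interpret H: group H by fact
  have closed: "free_lift H f w \<in> carrier H" if "fst ` set w \<subseteq> X" for w
    using that f by (induction w) (auto simp: free_lift_def)
  have cancel: "free_lift H f (cancel_cons a w) = free_lift H f (a # w)"
    if "fst a \<in> X" "fst ` set w \<subseteq> X" for a w
  proof (cases w)
    case (Cons b v)
    have "free_lift H f v \<in> carrier H" using closed that Cons by auto
    moreover have "f (fst a) \<in> carrier H" using f that by auto
    ultimately show ?thesis
      by (auto simp: Cons free_lift_def inv_letter_def)
  qed simp
  have "free_lift H f (foldr cancel_cons u v) = free_lift H f u \<otimes>\<^bsub>H\<^esub> free_lift H f v"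
    if "fst ` set u \<subseteq> X" "fst ` set v \<subseteq> X" for u v
    using that
  proof (induction u)
    case Nil
    then show ?case using closed[of v] by (simp add: free_lift_def)
  next
    case (Cons a u)
    have "fst ` set (foldr cancel_cons u v) \<subseteq> X"
      using set_foldr[of u v] Cons.prems by fastforce
    then have "free_lift H f (foldr cancel_cons (a # u) v) =
        free_lift H f (a # foldr cancel_cons u v)"
      using Cons.prems by (simp add: cancel)
    also have "\<dots> = free_lift H f (a # u) \<otimes>\<^bsub>H\<^esub> free_lift H f v"
      using Cons f closed[of u] closed[of v] by (auto simp: free_lift_def H.m_assoc Pi_iff)
    finally show ?case .
  qed
  then show ?thesis
    using closed by (auto simp: hom_def free_group_def)
qed

lemma free_lift_gen:
  assumes "group H" "f x \<in> carrier H"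
  shows "free_lift H f (free_gen x) = f x"
  using assms by (simp add: free_lift_def free_gen_def group.is_monoid)

lemma free_group_hom_eqI:
  assumes "group H" "g \<in> hom (free_group X) H" "h \<in> hom (free_group X) H"
    and eq: "\<And>x. x \<in> X \<Longrightarrow> g (free_gen x) = h (free_gen x)"
    and w: "w \<in> carrier (free_group X)"
  shows "g w = h w"
proof -
  interpret F: group "free_group X" by (rule group_free_group)
  interpret g: group_hom "free_group X" H g
    using assms by (simp add: group_hom_def group_hom_axioms_def group_free_group)
  interpret h: group_hom "free_group X" H h
    using assms by (simp add: group_hom_def group_hom_axioms_def group_free_group)
  show ?thesis
    using w by (induction rule: free_group_induct) (auto simp: eq)
qed

section \<open>Normal closures and presented groups\<close>

lemma normal_closure_normal:
  assumes "group G" "R \<subseteq> carrier G"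
  shows "normal_closure G R \<lhd> G"
proof -
  interpret group G by fact
  \<comment> \<open>The whole group belongs to the family, so the intersection is not taken over the
    empty family.\<close>
  have "carrier G \<lhd> G" using normal_inv_iff subgroup_self by auto
  then have "{N. N \<lhd> G \<and> R \<subseteq> N} \<noteq> {}" using assms by auto
  then have "subgroup (normal_closure G R) G"
    unfolding normal_closure_def
    by (intro subgroups_Inter) (auto simp: normal_imp_subgroup)
  then show ?thesis
    unfolding normal_inv_iff by (auto simp: normal_closure_def normal_inv_iff)
qed

lemma normal_closure_least: "N \<lhd> G \<Longrightarrow> R \<subseteq> N \<Longrightarrow> normal_closure G R \<subseteq> N"
  by (auto simp: normal_closure_def)

lemma normal_closure_superset: "R \<subseteq> normal_closure G R"
  by (auto simp: normal_closure_def)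

context
  fixes X :: "'a set" and R :: "'a word set"
  assumes R: "R \<subseteq> carrier (free_group X)"
begin

interpretation F: group "free_group X" by (rule group_free_group)

interpretation N: normal "normal_closure (free_group X) R" "free_group X"
  by (rule normal_closure_normal[OF F.group_axioms R])

lemma group_presented_group: "group (presented_group X R)"
  unfolding presented_group_def by (rule N.factorgroup_is_group)

interpretation P: group "presented_group X R" by (rule group_presented_group)

interpretation proj: group_hom "free_group X" "presented_group X R"
  "\<lambda>w. normal_closure (free_group X) R #>\<^bsub>free_group X\<^esub> w"
  unfolding presented_group_def group_hom_def group_hom_axioms_def
  using N.r_coset_hom_Mod N.factorgroup_is_group by auto

lemma presented_gen_in_carrier: "x \<in> X \<Longrightarrow> presented_gen X R x \<in> carrier (presented_group X R)"
  unfolding presented_gen_def by (rule proj.hom_closed) simp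

text \<open>Every coset has a representing word; induction on that word is carried through the
  projection homomorphism.\<close>

lemma presented_group_induct [consumes 1, case_names one gen inv_gen]:
  assumes "g \<in> carrier (presented_group X R)"
    and "P \<one>\<^bsub>presented_group X R\<^esub>"
    and "\<And>x g. \<lbrakk>x \<in> X; g \<in> carrier (presented_group X R); P g\<rbrakk> \<Longrightarrow>
          P (presented_gen X R x \<otimes>\<^bsub>presented_group X R\<^esub> g)"
    and "\<And>x g. \<lbrakk>x \<in> X; g \<in> carrier (presented_group X R); P g\<rbrakk> \<Longrightarrow>
          P (inv\<^bsub>presented_group X R\<^esub> presented_gen X R x \<otimes>\<^bsub>presented_group X R\<^esub> g)"
  shows "P g"
proof -
  obtain w where w: "w \<in> carrier (free_group X)"
    and g: "g = normal_closure (free_group X) R #>\<^bsub>free_group X\<^esub> w"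
    using assms(1) by (auto simp: presented_group_def carrier_FactGroup)
  show ?thesis
    unfolding g using w
    by (induction rule: free_group_induct)
      (simp_all only: proj.hom_one proj.hom_mult proj.hom_inv F.inv_closed free_gen_in_carrier
        assms(2) assms(3,4)[unfolded presented_gen_def] proj.hom_closed)
qed

text \<open>A relator lies in the normal closure, so its coset is trivial. The two shapes are
  exactly those of the twin relators.\<close>

lemma presented_gen_rel:
  assumes "x \<in> X" "y \<in> X"
  shows "free_gen x \<otimes>\<^bsub>free_group X\<^esub> free_gen y \<in> R \<Longrightarrow>
      presented_gen X R x \<otimes>\<^bsub>presented_group X R\<^esub> presented_gen X R y = \<one>\<^bsub>presented_group X R\<^esub>"
    and "(free_gen x \<otimes>\<^bsub>free_group X\<^esub> free_gen y) \<otimes>\<^bsub>free_group X\<^esub>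
        inv\<^bsub>free_group X\<^esub> (free_gen y \<otimes>\<^bsub>free_group X\<^esub> free_gen x) \<in> R \<Longrightarrow>
      presented_gen X R x \<otimes>\<^bsub>presented_group X R\<^esub> presented_gen X R y =
      presented_gen X R y \<otimes>\<^bsub>presented_group X R\<^esub> presented_gen X R x"
proof -
  have one: "normal_closure (free_group X) R #>\<^bsub>free_group X\<^esub> w = \<one>\<^bsub>presented_group X R\<^esub>"
    if "w \<in> R" for w
    using that normal_closure_superset[of R "free_group X"]
    by (simp add: presented_group_def F.coset_join2 N.subgroup_axioms R[THEN subsetD] subsetD)
  show "presented_gen X R x \<otimes>\<^bsub>presented_group X R\<^esub> presented_gen X R y = \<one>\<^bsub>presented_group X R\<^esub>"
    if "free_gen x \<otimes>\<^bsub>free_group X\<^esub> free_gen y \<in> R"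
    using one[OF that] assms by (simp add: presented_gen_def)
  show "presented_gen X R x \<otimes>\<^bsub>presented_group X R\<^esub> presented_gen X R y =
      presented_gen X R y \<otimes>\<^bsub>presented_group X R\<^esub> presented_gen X R x"
    if "(free_gen x \<otimes>\<^bsub>free_group X\<^esub> free_gen y) \<otimes>\<^bsub>free_group X\<^esub>
        inv\<^bsub>free_group X\<^esub> (free_gen y \<otimes>\<^bsub>free_group X\<^esub> free_gen x) \<in> R"
    using one[OF that] assms
    \<comment> \<open>The inverse of the product must stay in one piece to be moved to the other
      side, hence the deletion of \<open>inv_mult_group\<close>.\<close>
    by (simp add: presented_gen_def P.inv_solve_right'[of "\<one>\<^bsub>presented_group X R\<^esub>"]
        del: P.inv_mult_group)
qed

text \<open>Von Dyck's theorem: the kernel of \<open>free_lift H f\<close> is normal and contains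
  \<open>R\<close>, hence contains the normal closure, and the map factors through the
  quotient.\<close>

lemma presented_group_lift:
  assumes "group H" and f: "f \<in> X \<rightarrow> carrier H"
    and rel: "\<And>r. r \<in> R \<Longrightarrow> free_lift H f r = \<one>\<^bsub>H\<^esub>"
  obtains \<psi> where "\<psi> \<in> hom (presented_group X R) H"
    and "\<And>x. x \<in> X \<Longrightarrow> \<psi> (presented_gen X R x) = f x"
proof -
  interpret h: group_hom "free_group X" H "free_lift H f"
    using free_lift_hom[OF assms(1) f] assms(1)
    by (simp add: group_hom_def group_hom_axioms_def F.group_axioms)
  have "normal_closure (free_group X) R \<subseteq> kernel (free_group X) H (free_lift H f)"
    using rel R by (intro normal_closure_least h.normal_kernel) (auto simp: kernel_def)
  then obtain \<psi> where "\<psi> \<in> hom (presented_group X R) H"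
    "\<And>w. w \<in> carrier (free_group X) \<Longrightarrow>
      \<psi> (normal_closure (free_group X) R #>\<^bsub>free_group X\<^esub> w) = free_lift H f w"
    unfolding presented_group_def using h.FactGroup_universal_kernel[OF N.normal_axioms] by metis
  then show thesis
    using that f \<open>group H\<close> by (simp add: presented_gen_def free_lift_gen Pi_iff)
qed

end

section \<open>Twin groups\<close>

text \<open>Keeps index sets such as \<open>{1..n - 1}\<close> in the form in which the interpreted locales know them.\<close>

declare One_nat_def [simp del]

lemma twin_relators_closed: "twin_relators n \<subseteq> carrier (free_group {1..n - 1})"
proof -
  interpret F: group "free_group {1..n - 1}" by (rule group_free_group)
  show ?thesis by (auto simp: twin_relators_def Let_def simp del: F.inv_mult_group)
qed

lemma group_twin_group: "group (twin_group n)"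
  unfolding twin_group_def by (rule group_presented_group[OF twin_relators_closed])

lemma twin_gen_in_carrier [simp]: "i \<in> {1..n - 1} \<Longrightarrow> twin_gen n i \<in> carrier (twin_group n)"
  unfolding twin_group_def twin_gen_def by (rule presented_gen_in_carrier[OF twin_relators_closed])

lemma twin_gen_square:
  assumes "i \<in> {1..n - 1}"
  shows "twin_gen n i \<otimes>\<^bsub>twin_group n\<^esub> twin_gen n i = \<one>\<^bsub>twin_group n\<^esub>"
  unfolding twin_group_def twin_gen_def
  by (rule presented_gen_rel(1)[OF twin_relators_closed])
    (use assms in \<open>auto simp: twin_relators_def Let_def\<close>)

text \<open>The case of inverse generators disappears because each generator is an
  involution.\<close>

lemma twin_group_induct [consumes 1, case_names one gen]:
  assumes "g \<in> carrier (twin_group n)"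
    and "P \<one>\<^bsub>twin_group n\<^esub>"
    and "\<And>i g. \<lbrakk>i \<in> {1..n - 1}; g \<in> carrier (twin_group n); P g\<rbrakk> \<Longrightarrow>
          P (twin_gen n i \<otimes>\<^bsub>twin_group n\<^esub> g)"
  shows "P g"
proof -
  interpret T: group "twin_group n" by (rule group_twin_group)
  have "inv\<^bsub>twin_group n\<^esub> twin_gen n i = twin_gen n i" if "i \<in> {1..n - 1}" for i
    using that by (intro T.inv_equality) (auto simp: twin_gen_square)
  with assms show ?thesis
    using presented_group_induct[OF twin_relators_closed, of g n P]
    by (simp add: twin_group_def twin_gen_def)
qed

lemma twin_group_hom_eqI:
  assumes "group H" "\<phi> \<in> hom (twin_group n) H" "\<psi> \<in> hom (twin_group n) H"
    and eq: "\<And>i. i \<in> {1..n - 1} \<Longrightarrow> \<phi> (twin_gen n i) = \<psi> (twin_gen n i)"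
    and g: "g \<in> carrier (twin_group n)"
  shows "\<phi> g = \<psi> g"
  using g
proof (induction rule: twin_group_induct)
  case one
  show ?case using assms(1-3) group_twin_group by (metis hom_one)
next
  case (gen i g)
  then show ?case
    using hom_mult[OF assms(2)] hom_mult[OF assms(3)] by (simp add: eq)
qed

text \<open>The universal property with the relators translated back into the relations that they
  encode.\<close>

lemma twin_group_lift:
  assumes "group H" and f: "\<And>i. i \<in> {1..n - 1} \<Longrightarrow> f i \<in> carrier H"
    and sq: "\<And>i. i \<in> {1..n - 1} \<Longrightarrow> f i \<otimes>\<^bsub>H\<^esub> f i = \<one>\<^bsub>H\<^esub>"
    and comm: "\<And>i j. \<lbrakk>i \<in> {1..n - 1}; j \<in> {1..n - 1}; \<bar>int i - int j\<bar> \<ge> 2\<rbrakk> \<Longrightarrow>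
          f i \<otimes>\<^bsub>H\<^esub> f j = f j \<otimes>\<^bsub>H\<^esub> f i"
  obtains \<psi> where "\<psi> \<in> hom (twin_group n) H"
    and "\<And>i. i \<in> {1..n - 1} \<Longrightarrow> \<psi> (twin_gen n i) = f i"
proof -
  interpret H: group H by fact
  interpret F: group "free_group {1..n - 1}" by (rule group_free_group)
  have fX: "f \<in> {1..n - 1} \<rightarrow> carrier H" using f by auto
  interpret h: group_hom "free_group {1..n - 1}" H "free_lift H f"
    using free_lift_hom[OF assms(1) fX]
    by (simp add: group_hom_def group_hom_axioms_def F.group_axioms H.group_axioms)
  have gen: "free_lift H f (free_gen i) = f i" if "i \<in> {1..n - 1}" for i
    using f[OF that] by (simp add: free_lift_gen H.group_axioms)
  have "free_lift H f r = \<one>\<^bsub>H\<^esub>" if r: "r \<in> twin_relators n" for r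
  proof -
    consider i where "i \<in> {1..n - 1}" "r = free_gen i \<otimes>\<^bsub>free_group {1..n - 1}\<^esub> free_gen i"
      | i j where "i \<in> {1..n - 1}" "j \<in> {1..n - 1}" "\<bar>int i - int j\<bar> \<ge> 2"
        "r = (free_gen i \<otimes>\<^bsub>free_group {1..n - 1}\<^esub> free_gen j) \<otimes>\<^bsub>free_group {1..n - 1}\<^esub>
           inv\<^bsub>free_group {1..n - 1}\<^esub> (free_gen j \<otimes>\<^bsub>free_group {1..n - 1}\<^esub> free_gen i)"
      using r unfolding twin_relators_def Let_def by blast
    then show ?thesis
    proof cases
      case 1
      then show ?thesis by (simp add: gen sq del: atLeastAtMost_iff)
    next
      case 2
      then show ?thesis
        by (simp add: gen f comm[OF 2(1-3)] del: atLeastAtMost_iff F.inv_mult_group H.inv_mult_group)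
    qed
  qed
  from presented_group_lift[OF twin_relators_closed H.group_axioms fX this] that
  show thesis unfolding twin_group_def twin_gen_def by blast
qed

section \<open>The representation\<close>

lemma AutoGroup_mult_apply:
  assumes "f \<in> carrier (AutoGroup G)" "g \<in> carrier (AutoGroup G)" "w \<in> carrier G"
  shows "(f \<otimes>\<^bsub>AutoGroup G\<^esub> g) w = f (g w)"
  using assms by (simp add: AutoGroup_def BijGroup_def auto_def compose_def)

lemma AutoGroup_one_apply: "w \<in> carrier G \<Longrightarrow> \<one>\<^bsub>AutoGroup G\<^esub> w = w"
  by (simp add: AutoGroup_def BijGroup_def)

lemma AutoGroup_hom: "f \<in> carrier (AutoGroup G) \<Longrightarrow> f \<in> hom G G"
  by (simp add: AutoGroup_def auto_def)

text \<open>Automorphisms are extensional, so agreement on the carrier is equality, and agreement on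
  the carrier follows from agreement on generators.\<close>

lemma AutoGroup_free_group_eqI:
  assumes f: "f \<in> carrier (AutoGroup (free_group X))" and g: "g \<in> carrier (AutoGroup (free_group X))"
    and "\<And>x. x \<in> X \<Longrightarrow> f (free_gen x) = g (free_gen x)"
  shows "f = g"
proof (rule extensionalityI)
  show "f \<in> extensional (carrier (free_group X))" "g \<in> extensional (carrier (free_group X))"
    using f g by (auto simp: AutoGroup_def auto_def Bij_def)
  show "f w = g w" if "w \<in> carrier (free_group X)" for w
    using free_group_hom_eqI[OF group_free_group AutoGroup_hom[OF f] AutoGroup_hom[OF g]] assms(3) that
    by blast
qed

lemma mu_gen_image_closed:
  assumes "i \<in> {1..n - 1}" "j \<in> {1..n}"
  shows "mu_gen_image n i j \<in> carrier (free_group {1..n})"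
proof -
  interpret F: group "free_group {1..n}" by (rule group_free_group)
  show ?thesis using assms by (auto simp: mu_gen_image_def Let_def)
qed

text \<open>Bijectivity holds because the endomorphism is an involution.\<close>

lemma mu_gen_aut_exists:
  assumes i: "i \<in> {1..n - 1}"
  obtains \<alpha> where "\<alpha> \<in> carrier (AutoGroup (free_group {1..n}))"
    and "\<And>j. j \<in> {1..n} \<Longrightarrow> \<alpha> (free_gen j) = mu_gen_image n i j"
    and "\<alpha> \<otimes>\<^bsub>AutoGroup (free_group {1..n})\<^esub> \<alpha> = \<one>\<^bsub>AutoGroup (free_group {1..n})\<^esub>"
proof -
  let ?F = "free_group {1..n}"
  interpret F: group ?F by (rule group_free_group)
  interpret A: group "AutoGroup ?F" by (rule F.AutoGroup)
  define \<beta> where "\<beta> = free_lift ?F (mu_gen_image n i)"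
  have \<beta>: "\<beta> \<in> hom ?F ?F"
    unfolding \<beta>_def using mu_gen_image_closed[OF i] by (intro free_lift_hom F.group_axioms) auto
  interpret \<beta>: group_hom ?F ?F \<beta>
    using \<beta> by (simp add: group_hom_def group_hom_axioms_def F.group_axioms)
  have gen: "\<beta> (free_gen j) = mu_gen_image n i j" if "j \<in> {1..n}" for j
    unfolding \<beta>_def using mu_gen_image_closed[OF i that] by (simp add: free_lift_gen F.group_axioms)
  \<comment> \<open>The only case with any content is \<open>x_i\<close>, which goes to
    \<open>x_i x_{i+1}\<close> and then to \<open>x_i x_{i+1} x_{i+1}^-1\<close>.\<close>
  have "\<beta> (\<beta> (free_gen j)) = free_gen j" if "j \<in> {1..n}" for j
    using i that
    by (auto simp: gen mu_gen_image_def Let_def F.m_assoc)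
  then have inv: "\<beta> (\<beta> w) = w" if "w \<in> carrier ?F" for w
    using free_group_hom_eqI[OF F.group_axioms Group.hom_compose[OF \<beta> \<beta>], of "\<lambda>w. w"] that
    by (auto simp: hom_def)
  \<comment> \<open>Restriction supplies the extensionality required of members of
    \<open>AutoGroup\<close>.\<close>
  define \<alpha> where "\<alpha> = restrict \<beta> (carrier ?F)"
  have "bij_betw \<alpha> (carrier ?F) (carrier ?F)"
    unfolding \<alpha>_def by (rule bij_betwI[where g = \<beta>]) (auto simp: inv)
  moreover have "\<alpha> \<in> hom ?F ?F"
    using \<beta> by (auto simp: \<alpha>_def hom_def)
  ultimately have \<alpha>: "\<alpha> \<in> carrier (AutoGroup ?F)"
    by (auto simp: AutoGroup_def auto_def Bij_def \<alpha>_def)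
  have "\<alpha> \<otimes>\<^bsub>AutoGroup ?F\<^esub> \<alpha> = \<one>\<^bsub>AutoGroup ?F\<^esub>"
    using \<alpha> by (intro AutoGroup_free_group_eqI)
      (auto simp: AutoGroup_mult_apply AutoGroup_one_apply inv \<alpha>_def)
  with \<alpha> show thesis
    using that gen by (auto simp: \<alpha>_def)
qed

text \<open>Each free generator is fixed by at least one of the two maps, and its image under the
  other involves only generators fixed by the first.\<close>

lemma mu_gen_aut_commute:
  assumes i: "i \<in> {1..n - 1}" and j: "j \<in> {1..n - 1}" and ij: "\<bar>int i - int j\<bar> \<ge> 2"
    and \<alpha>: "\<alpha> \<in> carrier (AutoGroup (free_group {1..n}))"
    and \<alpha>_gen: "\<And>k. k \<in> {1..n} \<Longrightarrow> \<alpha> (free_gen k) = mu_gen_image n i k"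
    and \<beta>: "\<beta> \<in> carrier (AutoGroup (free_group {1..n}))"
    and \<beta>_gen: "\<And>k. k \<in> {1..n} \<Longrightarrow> \<beta> (free_gen k) = mu_gen_image n j k"
  shows "\<alpha> \<otimes>\<^bsub>AutoGroup (free_group {1..n})\<^esub> \<beta> = \<beta> \<otimes>\<^bsub>AutoGroup (free_group {1..n})\<^esub> \<alpha>"
proof -
  let ?F = "free_group {1..n}"
  interpret F: group ?F by (rule group_free_group)
  interpret A: group "AutoGroup ?F" by (rule F.AutoGroup)
  interpret \<alpha>: group_hom ?F ?F \<alpha>
    using AutoGroup_hom[OF \<alpha>] by (simp add: group_hom_def group_hom_axioms_def F.group_axioms)
  interpret \<beta>: group_hom ?F ?F \<beta>
    using AutoGroup_hom[OF \<beta>] by (simp add: group_hom_def group_hom_axioms_def F.group_axioms)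
  have "\<alpha> (\<beta> (free_gen k)) = \<beta> (\<alpha> (free_gen k))" if "k \<in> {1..n}" for k
    using i j ij that by (auto simp: \<alpha>_gen \<beta>_gen mu_gen_image_def Let_def)
  then show ?thesis
    using \<alpha> \<beta> by (intro AutoGroup_free_group_eqI) (auto simp: AutoGroup_mult_apply)
qed

lemma mu_gen_aut_unique_exists:
  assumes "i \<in> {1..n - 1}"
  shows "\<exists>!\<alpha>. \<alpha> \<in> carrier (AutoGroup (free_group {1..n})) \<and>
    (\<forall>j\<in>{1..n}. \<alpha> (free_gen j) = mu_gen_image n i j)"
proof -
  obtain \<alpha> where "\<alpha> \<in> carrier (AutoGroup (free_group {1..n}))"
    "\<And>j. j \<in> {1..n} \<Longrightarrow> \<alpha> (free_gen j) = mu_gen_image n i j"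
    using mu_gen_aut_exists[OF assms] by metis
  then show ?thesis
    by (intro ex1I[of _ \<alpha>]) (auto intro!: AutoGroup_free_group_eqI)
qed

text \<open>Existence is the universal property of the twin group. Uniqueness uses generation twice:
  an automorphism is determined on the free generators, and a homomorphism on the twin
  generators.\<close>

lemma is_mu_unique_exists: "\<exists>!\<mu>. is_mu n \<mu>"
proof -
  let ?A = "AutoGroup (free_group {1..n})"
  let ?T = "twin_group n"
  interpret A: group ?A by (rule group.AutoGroup[OF group_free_group])
  have "\<forall>i\<in>{1..n - 1}. \<exists>\<alpha>. \<alpha> \<in> carrier ?A \<and>
      (\<forall>j\<in>{1..n}. \<alpha> (free_gen j) = mu_gen_image n i j) \<and> \<alpha> \<otimes>\<^bsub>?A\<^esub> \<alpha> = \<one>\<^bsub>?A\<^esub>"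
    by (metis mu_gen_aut_exists)
  then obtain \<alpha> where \<alpha>: "\<And>i. i \<in> {1..n - 1} \<Longrightarrow> \<alpha> i \<in> carrier ?A"
    and gen: "\<And>i j. \<lbrakk>i \<in> {1..n - 1}; j \<in> {1..n}\<rbrakk> \<Longrightarrow> \<alpha> i (free_gen j) = mu_gen_image n i j"
    and sq: "\<And>i. i \<in> {1..n - 1} \<Longrightarrow> \<alpha> i \<otimes>\<^bsub>?A\<^esub> \<alpha> i = \<one>\<^bsub>?A\<^esub>"
    by metis
  have comm: "\<alpha> i \<otimes>\<^bsub>?A\<^esub> \<alpha> j = \<alpha> j \<otimes>\<^bsub>?A\<^esub> \<alpha> i"
    if "i \<in> {1..n - 1}" "j \<in> {1..n - 1}" "\<bar>int i - int j\<bar> \<ge> 2" for i j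
    by (rule mu_gen_aut_commute[OF that \<alpha>[OF that(1)] gen[OF that(1)] \<alpha>[OF that(2)] gen[OF that(2)]])
  obtain \<psi> where \<psi>: "\<psi> \<in> hom ?T ?A"
    and \<psi>_gen: "\<And>i. i \<in> {1..n - 1} \<Longrightarrow> \<psi> (twin_gen n i) = \<alpha> i"
    using twin_group_lift[OF A.group_axioms, of n \<alpha>] \<alpha> sq comm by blast
  show ?thesis
  proof (rule ex1I)
    show "is_mu n (restrict \<psi> (carrier ?T))"
      using \<psi> \<psi>_gen gen group_twin_group
      by (auto simp: is_mu_def hom_def group.is_monoid monoid.m_closed simp del: atLeastAtMost_iff)
  next
    fix \<mu> assume \<mu>: "is_mu n \<mu>"
    then have hom: "\<mu> \<in> hom ?T ?A" by (simp add: is_mu_def)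
    have "\<mu> (twin_gen n i) = \<psi> (twin_gen n i)" if "i \<in> {1..n - 1}" for i
    proof (rule AutoGroup_free_group_eqI)
      show "\<mu> (twin_gen n i) \<in> carrier ?A" "\<psi> (twin_gen n i) \<in> carrier ?A"
        using hom \<psi> that by (auto simp: hom_def simp del: atLeastAtMost_iff)
      show "\<mu> (twin_gen n i) (free_gen j) = \<psi> (twin_gen n i) (free_gen j)" if "j \<in> {1..n}" for j
        using \<mu> \<open>i \<in> {1..n - 1}\<close> that by (simp add: is_mu_def \<psi>_gen gen del: atLeastAtMost_iff)
    qed
    then have "\<mu> g = \<psi> g" if "g \<in> carrier ?T" for g
      using twin_group_hom_eqI[OF A.group_axioms hom \<psi>] that by blast
    then show "\<mu> = restrict \<psi> (carrier ?T)"
      using \<mu> by (intro extensionalityI[of _ "carrier ?T"]) (auto simp: is_mu_def)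
  qed
qed

section \<open>Faithfulness for at most three strands\<close>

text \<open>This is the \<open>x\<close>-coordinate of a word in the abelianization of the free
  group.\<close>

definition exponent_sum :: "'a \<Rightarrow> 'a word \<Rightarrow> int" where
  "exponent_sum x w = (\<Sum>a\<leftarrow>w. if fst a = x then if snd a then 1 else -1 else 0)"

text \<open>A cancellation removes two letters with the same generator and opposite signs, which
  contribute zero in total.\<close>

lemma exponent_sum_mult [simp]:
  "exponent_sum x (u \<otimes>\<^bsub>free_group X\<^esub> v) = exponent_sum x u + exponent_sum x v"
proof -
  have "exponent_sum x (cancel_cons a w) = exponent_sum x (a # w)" for a w
    by (cases w) (auto simp: exponent_sum_def inv_letter_def)
  then have "exponent_sum x (foldr cancel_cons u v) = exponent_sum x u + exponent_sum x v"
    by (induction u) (simp_all add: exponent_sum_def)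
  then show ?thesis by (simp add: free_group_def)
qed

lemma exponent_sum_one [simp]: "exponent_sum x \<one>\<^bsub>free_group X\<^esub> = 0"
  by (simp add: exponent_sum_def free_group_def)

lemma exponent_sum_free_gen [simp]: "exponent_sum x (free_gen y) = (if x = y then 1 else 0)"
  by (simp add: exponent_sum_def free_gen_def)

lemma exponent_sum_inv [simp]:
  assumes "w \<in> carrier (free_group X)"
  shows "exponent_sum x (inv\<^bsub>free_group X\<^esub> w) = - exponent_sum x w"
proof -
  have "inv\<^bsub>free_group X\<^esub> w \<otimes>\<^bsub>free_group X\<^esub> w = \<one>\<^bsub>free_group X\<^esub>"
    by (rule group.l_inv[OF group_free_group assms])
  then have "exponent_sum x (inv\<^bsub>free_group X\<^esub> w) + exponent_sum x w = 0"
    by (metis exponent_sum_mult exponent_sum_one)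
  then show ?thesis by simp
qed

section \<open>Evaluation of a representation and its action on the abelianization\<close>

lemma is_mu_group_hom:
  assumes "is_mu n \<mu>"
  shows "group_hom (twin_group n) (AutoGroup (free_group {1..n})) \<mu>"
    and "g \<in> carrier (twin_group n) \<Longrightarrow> group_hom (free_group {1..n}) (free_group {1..n}) (\<mu> g)"
proof -
  show hom: "group_hom (twin_group n) (AutoGroup (free_group {1..n})) \<mu>"
    using assms group_twin_group group.AutoGroup[OF group_free_group]
    by (simp add: is_mu_def group_hom_def group_hom_axioms_def)
  show "group_hom (free_group {1..n}) (free_group {1..n}) (\<mu> g)" if "g \<in> carrier (twin_group n)"
    using AutoGroup_hom[OF group_hom.hom_closed[OF hom that]] group_free_group
    by (simp add: group_hom_def group_hom_axioms_def)
qed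

lemma is_mu_mult_apply:
  assumes "is_mu n \<mu>" "g \<in> carrier (twin_group n)" "h \<in> carrier (twin_group n)"
    and "w \<in> carrier (free_group {1..n})"
  shows "\<mu> (g \<otimes>\<^bsub>twin_group n\<^esub> h) w = \<mu> g (\<mu> h w)"
  using assms is_mu_group_hom(1)[OF assms(1)]
  by (simp add: group_hom.hom_mult group_hom.hom_closed AutoGroup_mult_apply)

lemma is_mu_one_apply:
  assumes "is_mu n \<mu>" "w \<in> carrier (free_group {1..n})"
  shows "\<mu> \<one>\<^bsub>twin_group n\<^esub> w = w"
  using assms group_hom.hom_one[OF is_mu_group_hom(1)[OF assms(1)]]
  by (simp add: AutoGroup_one_apply)

text \<open>In the abelianization, \<open>x_i\<close> contributes its exponent to coordinate
  \<open>i + 1\<close> as well, where the inversion of \<open>x_{i+1}\<close> negates the old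
  entry.\<close>

lemma exponent_sum_mu_gen:
  assumes \<mu>: "is_mu n \<mu>" and i: "i \<in> {1..n - 1}" and w: "w \<in> carrier (free_group {1..n})"
  shows "exponent_sum k (\<mu> (twin_gen n i) w) =
    (if k = i + 1 then exponent_sum i w - exponent_sum (i + 1) w else exponent_sum k w)"
proof -
  let ?F = "free_group {1..n}"
  interpret F: group ?F by (rule group_free_group)
  interpret \<alpha>: group_hom ?F ?F "\<mu> (twin_gen n i)"
    using is_mu_group_hom(2)[OF \<mu> twin_gen_in_carrier[OF i]] .
  have gen: "\<mu> (twin_gen n i) (free_gen j) = mu_gen_image n i j" if "j \<in> {1..n}" for j
    using \<mu> i that by (simp add: is_mu_def)
  show ?thesis
    using w i
    by (induction rule: free_group_induct) (auto simp: gen mu_gen_image_def Let_def)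
qed

text \<open>The dihedral relation: conjugation by \<open>s\<close> inverts \<open>p\<close>, hence
  inverts every power of \<open>p\<close>.\<close>

lemma (in group) involution_int_pow:
  assumes s: "s \<in> carrier G" "s \<otimes> s = \<one>" and p: "p \<in> carrier G"
    and sp: "s \<otimes> p = inv p \<otimes> s"
  shows "s \<otimes> p [^] (k :: int) = p [^] (- k) \<otimes> s"
proof -
  \<comment> \<open>The base \<open>q\<close> is kept general so that negative exponents can be
    treated with \<open>q = inv p\<close>.\<close>
  have nat_case: "s \<otimes> q [^] m = inv q [^] m \<otimes> s"
    if q: "q \<in> carrier G" "s \<otimes> q = inv q \<otimes> s" for q and m :: nat
  proof (induction m)
    case 0
    then show ?case using s by simp
  next
    case (Suc m)
    have "s \<otimes> q [^] Suc m = (s \<otimes> q [^] m) \<otimes> q" using s q by (simp add: m_assoc)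
    also have "\<dots> = inv q [^] m \<otimes> (s \<otimes> q)" using s q by (simp add: Suc m_assoc)
    also have "\<dots> = inv q [^] Suc m \<otimes> s" using s q by (simp add: m_assoc)
    finally show ?case .
  qed
  \<comment> \<open>Inserting \<open>s \<otimes> s = \<one>\<close> on the right yields the same
    relation for \<open>inv p\<close>.\<close>
  have "s \<otimes> inv p = s \<otimes> (inv p \<otimes> s) \<otimes> s"
    using s p by (simp add: m_assoc)
  also have "\<dots> = (s \<otimes> s) \<otimes> p \<otimes> s"
    using s(1) p by (simp only: sp[symmetric] m_assoc m_closed)
  also have "\<dots> = p \<otimes> s"
    using s p by simp
  finally have neg: "s \<otimes> inv p [^] m = p [^] m \<otimes> s" for m :: nat
    using nat_case[of "inv p" m] p by simp
  show ?thesis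
    using nat_case[OF p sp] neg p by (cases k rule: int_cases2)
      (simp_all add: int_pow_int int_pow_neg nat_pow_inv)
qed

text \<open>
  For \<open>p = s\<^sub>1 s\<^sub>2\<close>, the element \<open>p\<^sup>k\<close> sends \<open>x\<^sub>2\<close> to \<open>(-1)\<^sup>k (x\<^sub>2 - k x\<^sub>3)\<close> and \<open>p\<^sup>k s\<^sub>1\<close> sends it to the
  negative of this in the abelianization.
\<close>

lemma twin_group_3_normal_form:
  assumes \<mu>: "is_mu 3 \<mu>" and g: "g \<in> carrier (twin_group 3)"
  shows "\<exists>(k :: int) b.
    g = (twin_gen 3 1 \<otimes>\<^bsub>twin_group 3\<^esub> twin_gen 3 2) [^]\<^bsub>twin_group 3\<^esub> k \<otimes>\<^bsub>twin_group 3\<^esub>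
      (if b then \<one>\<^bsub>twin_group 3\<^esub> else twin_gen 3 1) \<and>
    exponent_sum 1 (\<mu> g (free_gen 2)) = 0 \<and>
    exponent_sum 2 (\<mu> g (free_gen 2)) = (if even k = b then 1 else -1) \<and>
    exponent_sum 3 (\<mu> g (free_gen 2)) = (if even k = b then - k else k)"
proof -
  let ?T = "twin_group 3"
  interpret T: group ?T by (rule group_twin_group)
  let ?s = "twin_gen 3 1" and ?t = "twin_gen 3 2"
  let ?p = "?s \<otimes>\<^bsub>?T\<^esub> ?t"
  have s: "?s \<in> carrier ?T" "?s \<otimes>\<^bsub>?T\<^esub> ?s = \<one>\<^bsub>?T\<^esub>"
    and t: "?t \<in> carrier ?T" "?t \<otimes>\<^bsub>?T\<^esub> ?t = \<one>\<^bsub>?T\<^esub>"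
    by (simp_all add: twin_gen_square)
  have p: "?p \<in> carrier ?T" using s t by simp
  have inv_s: "inv\<^bsub>?T\<^esub> ?s = ?s" and inv_t: "inv\<^bsub>?T\<^esub> ?t = ?t"
    using s t T.inv_equality by auto
  have sp: "?s \<otimes>\<^bsub>?T\<^esub> ?p = ?t"
    using s t by (simp flip: T.m_assoc)
  have "?s \<otimes>\<^bsub>?T\<^esub> ?p = inv\<^bsub>?T\<^esub> ?p \<otimes>\<^bsub>?T\<^esub> ?s"
    using s t by (simp add: sp T.inv_mult_group inv_s inv_t T.m_assoc)
  note flip = T.involution_int_pow[OF s p this]
  show ?thesis
    using g
  proof (induction rule: twin_group_induct)
    case one
    then show ?case
      using \<mu> by (intro exI[of _ 0] exI[of _ True]) (simp add: is_mu_one_apply)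
  next
    case (gen i g)
    then obtain k :: int and b where
      g: "g = ?p [^]\<^bsub>?T\<^esub> k \<otimes>\<^bsub>?T\<^esub> (if b then \<one>\<^bsub>?T\<^esub> else ?s)"
      and e: "exponent_sum 1 (\<mu> g (free_gen 2)) = 0"
        "exponent_sum 2 (\<mu> g (free_gen 2)) = (if even k = b then 1 else -1)"
        "exponent_sum 3 (\<mu> g (free_gen 2)) = (if even k = b then - k else k)"
      by blast
    \<comment> \<open>Left multiplication by the involution \<open>?s\<close> toggles the flag
      \<open>b\<close>, and moving it past the power negates the exponent.\<close>
    let ?b = "if b then \<one>\<^bsub>?T\<^esub> else ?s" and ?b' = "if \<not> b then \<one>\<^bsub>?T\<^esub> else ?s"
    have bb': "?s \<otimes>\<^bsub>?T\<^esub> ?b = ?b'" using s by simp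
    have b: "?b \<in> carrier ?T" using s by simp
    have s_mult: "?s \<otimes>\<^bsub>?T\<^esub> (?p [^]\<^bsub>?T\<^esub> m \<otimes>\<^bsub>?T\<^esub> ?b) = ?p [^]\<^bsub>?T\<^esub> (- m) \<otimes>\<^bsub>?T\<^esub> ?b'" for m :: int
    proof -
      have "?s \<otimes>\<^bsub>?T\<^esub> (?p [^]\<^bsub>?T\<^esub> m \<otimes>\<^bsub>?T\<^esub> ?b) = (?s \<otimes>\<^bsub>?T\<^esub> ?p [^]\<^bsub>?T\<^esub> m) \<otimes>\<^bsub>?T\<^esub> ?b"
        using s(1) p b by (simp only: T.m_assoc T.int_pow_closed)
      also have "\<dots> = ?p [^]\<^bsub>?T\<^esub> (- m) \<otimes>\<^bsub>?T\<^esub> (?s \<otimes>\<^bsub>?T\<^esub> ?b)"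
        unfolding flip using s(1) p b by (simp only: T.m_assoc T.int_pow_closed)
      finally show ?thesis by (simp only: bb')
    qed
    have x: "free_gen 2 \<in> carrier (free_group {1..3::nat})" by simp
    have y: "\<mu> g (free_gen 2) \<in> carrier (free_group {1..3})"
      using group_hom.hom_closed[OF is_mu_group_hom(2)[OF \<mu> gen(2)] x] .
    have ap: "\<mu> (twin_gen 3 i \<otimes>\<^bsub>?T\<^esub> g) (free_gen 2) = \<mu> (twin_gen 3 i) (\<mu> g (free_gen 2))"
      using is_mu_mult_apply[OF \<mu> _ gen(2) x] gen(1) by simp
    note exps = exponent_sum_mu_gen[OF \<mu> gen(1) y]
    consider "i = 1" | "i = 2" using gen(1) by force
    then show ?case
    proof cases
      case 1
      have "?s \<otimes>\<^bsub>?T\<^esub> g = ?p [^]\<^bsub>?T\<^esub> (- k) \<otimes>\<^bsub>?T\<^esub> ?b'" unfolding g by (rule s_mult)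
      then show ?thesis
        unfolding ap exps e
        by (intro exI[of _ "- k"] exI[of _ "\<not> b"]) (simp add: 1 e)
    next
      case 2
      \<comment> \<open>As \<open>?t\<close> equals \<open>?s\<close> times \<open>?p\<close>, the
        second generator first raises the exponent by one and then acts as in the first
        case.\<close>
      have "?t \<otimes>\<^bsub>?T\<^esub> g = ?s \<otimes>\<^bsub>?T\<^esub> (?p \<otimes>\<^bsub>?T\<^esub> g)"
        using T.m_assoc[OF s(1) p gen(2)] by (simp only: sp)
      also have "?p \<otimes>\<^bsub>?T\<^esub> g = ?p [^]\<^bsub>?T\<^esub> (1 + k) \<otimes>\<^bsub>?T\<^esub> ?b"
        unfolding g T.int_pow_mult[OF p] using p b
        by (simp only: T.int_pow_1 T.m_assoc T.int_pow_closed)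
      finally have "?t \<otimes>\<^bsub>?T\<^esub> g = ?p [^]\<^bsub>?T\<^esub> (- (1 + k)) \<otimes>\<^bsub>?T\<^esub> ?b'" by (simp only: s_mult)
      then show ?thesis
        unfolding ap exps e
        by (intro exI[of _ "- (1 + k)"] exI[of _ "\<not> b"]) (simp add: 2 e)
    qed
  qed
qed

text \<open>If \<open>x_2\<close> is fixed, its \<open>x_3\<close>-exponent 0 forces
  \<open>k = 0\<close> in the normal form, and its \<open>x_2\<close>-exponent 1 then forces the
  flag \<open>b\<close> to be true.\<close>

lemma mu_3_injective:
  assumes \<mu>: "is_mu 3 \<mu>"
  shows "inj_on \<mu> (carrier (twin_group 3))"
proof (rule group_hom.trivial_ker_imp_inj[OF is_mu_group_hom(1)[OF \<mu>]])
  interpret T: group "twin_group 3" by (rule group_twin_group)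
  interpret \<mu>: group_hom "twin_group 3" "AutoGroup (free_group {1..3})" \<mu>
    by (rule is_mu_group_hom(1)[OF \<mu>])
  have "g = \<one>\<^bsub>twin_group 3\<^esub>"
    if g: "g \<in> carrier (twin_group 3)" and ker: "\<mu> g = \<one>\<^bsub>AutoGroup (free_group {1..3})\<^esub>" for g
  proof -
    have "\<mu> g (free_gen 2) = free_gen 2" by (simp add: ker AutoGroup_one_apply)
    with twin_group_3_normal_form[OF \<mu> g] show ?thesis by (auto split: if_splits)
  qed
  then show "kernel (twin_group 3) (AutoGroup (free_group {1..3})) \<mu> = {\<one>\<^bsub>twin_group 3\<^esub>}"
    by (auto simp: kernel_def)
qed

text \<open>The only candidates are the identity and \<open>s_1\<close>, and the latter negates the
  \<open>x_2\<close>-exponent of \<open>x_2\<close>.\<close>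

lemma mu_2_injective:
  assumes \<mu>: "is_mu 2 \<mu>"
  shows "inj_on \<mu> (carrier (twin_group 2))"
proof (rule group_hom.trivial_ker_imp_inj[OF is_mu_group_hom(1)[OF \<mu>]])
  interpret T: group "twin_group 2" by (rule group_twin_group)
  interpret \<mu>: group_hom "twin_group 2" "AutoGroup (free_group {1..2})" \<mu>
    by (rule is_mu_group_hom(1)[OF \<mu>])
  have "g = \<one>\<^bsub>twin_group 2\<^esub>"
    if g: "g \<in> carrier (twin_group 2)" and ker: "\<mu> g = \<one>\<^bsub>AutoGroup (free_group {1..2})\<^esub>" for g
  proof -
    have "g = \<one>\<^bsub>twin_group 2\<^esub> \<or> g = twin_gen 2 1"
      using g
    proof (induction rule: twin_group_induct)
      case (gen i g)
      then have "i = 1" by simp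
      with gen show ?case by (auto simp: twin_gen_square)
    qed simp
    moreover have "\<mu> (twin_gen 2 1) \<noteq> \<one>\<^bsub>AutoGroup (free_group {1..2})\<^esub>"
      using exponent_sum_mu_gen[OF \<mu>, of 1 "free_gen 2" 2]
      by (auto simp: AutoGroup_one_apply)
    ultimately show ?thesis using ker by blast
  qed
  then show "kernel (twin_group 2) (AutoGroup (free_group {1..2})) \<mu> = {\<one>\<^bsub>twin_group 2\<^esub>}"
    by (auto simp: kernel_def)
qed

section \<open>A kernel element for at least four strands\<close>

lemma BijGroup_mult_apply:
  assumes "f \<in> carrier (BijGroup S)" "g \<in> carrier (BijGroup S)" "x \<in> S"
  shows "(f \<otimes>\<^bsub>BijGroup S\<^esub> g) x = f (g x)"
  using assms by (simp add: BijGroup_def compose_def)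

text \<open>This map serves to show that two elements of the twin group differ. Permutations of all
  of \<open>nat\<close> are used, so the target does not depend on \<open>n\<close>.\<close>

lemma twin_group_to_permutations:
  obtains \<psi> where "\<psi> \<in> hom (twin_group n) (BijGroup UNIV)"
    and "\<And>i. i \<in> {1..n - 1} \<Longrightarrow> \<psi> (twin_gen n i) = transpose i (i + 1)"
proof (rule twin_group_lift[OF group_BijGroup[of UNIV], of n "\<lambda>i. transpose i (i + 1)"])
  have mem: "transpose i j \<in> carrier (BijGroup UNIV)" for i j :: nat
    by (simp add: BijGroup_def Bij_def)
  show "transpose i (i + 1) \<in> carrier (BijGroup UNIV)" for i :: nat
    by (rule mem)
  show "transpose i (i + 1) \<otimes>\<^bsub>BijGroup UNIV\<^esub> transpose i (i + 1) = \<one>\<^bsub>BijGroup UNIV\<^esub>" for i :: nat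
    using mem[of i "i + 1"] by (auto simp: BijGroup_mult_apply fun_eq_iff) (simp add: BijGroup_def)
  show "transpose i (i + 1) \<otimes>\<^bsub>BijGroup UNIV\<^esub> transpose j (j + 1) =
      transpose j (j + 1) \<otimes>\<^bsub>BijGroup UNIV\<^esub> transpose i (i + 1)"
    if "\<bar>int i - int j\<bar> \<ge> 2" for i j :: nat
    using mem[of i "i + 1"] mem[of j "j + 1"] that
    by (auto simp: BijGroup_mult_apply fun_eq_iff transpose_def)
qed (use that in blast)

lemma mu_not_injective:
  assumes \<mu>: "is_mu n \<mu>" and n: "n \<ge> 4"
  shows "\<not> inj_on \<mu> (carrier (twin_group n))"
proof
  assume inj: "inj_on \<mu> (carrier (twin_group n))"
  let ?T = "twin_group n" and ?F = "free_group {1..n}"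
  interpret T: group ?T by (rule group_twin_group)
  interpret F: group ?F by (rule group_free_group)
  interpret \<mu>: group_hom ?T "AutoGroup ?F" \<mu> by (rule is_mu_group_hom(1)[OF \<mu>])
  define s where "s = twin_gen n"
  have s: "s 1 \<in> carrier ?T" "s 2 \<in> carrier ?T" "s 3 \<in> carrier ?T"
    using n by (simp_all add: s_def)
  define u where "u = s 1 \<otimes>\<^bsub>?T\<^esub> s 3"
  \<comment> \<open>This is \<open>r s_1 r\<close> with \<open>r = s_2 s_3 s_2\<close>, nested to
    the right so that its image unfolds into iterated application.\<close>
  define v where "v = s 2 \<otimes>\<^bsub>?T\<^esub> (s 3 \<otimes>\<^bsub>?T\<^esub> (s 2 \<otimes>\<^bsub>?T\<^esub>
    (s 1 \<otimes>\<^bsub>?T\<^esub> (s 2 \<otimes>\<^bsub>?T\<^esub> (s 3 \<otimes>\<^bsub>?T\<^esub> s 2)))))"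
  have uv: "u \<in> carrier ?T" "v \<in> carrier ?T"
    using s by (simp_all add: u_def v_def)
  obtain \<psi> where \<psi>: "\<psi> \<in> hom ?T (BijGroup UNIV)"
    and \<psi>_gen: "\<And>i. i \<in> {1..n - 1} \<Longrightarrow> \<psi> (twin_gen n i) = transpose i (i + 1)"
    using twin_group_to_permutations[of n] by blast
  interpret \<psi>: group_hom ?T "BijGroup UNIV" \<psi>
    using \<psi> by (simp add: group_hom_def group_hom_axioms_def T.group_axioms group_BijGroup)
  have "\<psi> (s 1) = transpose 1 2" "\<psi> (s 2) = transpose 2 3" "\<psi> (s 3) = transpose 3 4"
    using n by (simp_all add: s_def \<psi>_gen)
  moreover have "\<psi> (g \<otimes>\<^bsub>?T\<^esub> h) k = \<psi> g (\<psi> h k)" if "g \<in> carrier ?T" "h \<in> carrier ?T" for g h k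
    using that by (simp add: BijGroup_mult_apply)
  \<comment> \<open>With \<open>u\<close> acting as \<open>(1 2)(3 4)\<close> and \<open>v\<close>
    as \<open>(1 4)\<close>, the point 1 goes to 3 under \<open>u v\<close> and to 2 under
    \<open>v u\<close>.\<close>
  ultimately have "\<psi> (u \<otimes>\<^bsub>?T\<^esub> v) 1 \<noteq> \<psi> (v \<otimes>\<^bsub>?T\<^esub> u) 1"
    using s by (simp add: u_def v_def transpose_def del: \<psi>.hom_mult)
  then have "u \<otimes>\<^bsub>?T\<^esub> v \<noteq> v \<otimes>\<^bsub>?T\<^esub> u" by auto
  moreover have "\<mu> (u \<otimes>\<^bsub>?T\<^esub> v) = \<mu> (v \<otimes>\<^bsub>?T\<^esub> u)"
  proof (rule AutoGroup_free_group_eqI)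
    show "\<mu> (u \<otimes>\<^bsub>?T\<^esub> v) \<in> carrier (AutoGroup ?F)" "\<mu> (v \<otimes>\<^bsub>?T\<^esub> u) \<in> carrier (AutoGroup ?F)"
      using uv by simp_all
    fix j assume j: "j \<in> {1..n}"
    interpret s1: group_hom ?F ?F "\<mu> (s 1)" by (rule is_mu_group_hom(2)[OF \<mu> s(1)])
    interpret s2: group_hom ?F ?F "\<mu> (s 2)" by (rule is_mu_group_hom(2)[OF \<mu> s(2)])
    interpret s3: group_hom ?F ?F "\<mu> (s 3)" by (rule is_mu_group_hom(2)[OF \<mu> s(3)])
    have gen: "\<mu> (s i) (free_gen k) = mu_gen_image n i k" if "i \<in> {1, 2, 3}" "k \<in> {1..n}" for i k
      using \<mu> n that by (auto simp: is_mu_def s_def)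
    have x: "free_gen 1 \<in> carrier ?F" "free_gen 2 \<in> carrier ?F"
      "free_gen 3 \<in> carrier ?F" "free_gen 4 \<in> carrier ?F" "free_gen j \<in> carrier ?F"
      using n j by simp_all
    have tab:
      "\<mu> (s 1) (free_gen 1) = free_gen 1 \<otimes>\<^bsub>?F\<^esub> free_gen 2"
      "\<mu> (s 1) (free_gen 2) = inv\<^bsub>?F\<^esub> free_gen 2"
      "\<mu> (s 1) (free_gen 3) = free_gen 3"
      "\<mu> (s 1) (free_gen 4) = free_gen 4"
      "\<mu> (s 2) (free_gen 1) = free_gen 1"
      "\<mu> (s 2) (free_gen 2) = free_gen 2 \<otimes>\<^bsub>?F\<^esub> free_gen 3"
      "\<mu> (s 2) (free_gen 3) = inv\<^bsub>?F\<^esub> free_gen 3"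
      "\<mu> (s 2) (free_gen 4) = free_gen 4"
      "\<mu> (s 3) (free_gen 1) = free_gen 1"
      "\<mu> (s 3) (free_gen 2) = free_gen 2"
      "\<mu> (s 3) (free_gen 3) = free_gen 3 \<otimes>\<^bsub>?F\<^esub> free_gen 4"
      "\<mu> (s 3) (free_gen 4) = inv\<^bsub>?F\<^esub> free_gen 4"
      using n by (simp_all add: gen mu_gen_image_def)
    have fixed: "\<mu> (s 1) (free_gen j) = free_gen j" "\<mu> (s 2) (free_gen j) = free_gen j"
      "\<mu> (s 3) (free_gen j) = free_gen j" if "j > 4"
      using j that by (simp_all add: gen mu_gen_image_def)
    have u: "\<mu> u w = \<mu> (s 1) (\<mu> (s 3) w)" if "w \<in> carrier ?F" for w
      unfolding u_def using s that by (simp only: is_mu_mult_apply[OF \<mu>])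
    have v: "\<mu> v w = \<mu> (s 2) (\<mu> (s 3) (\<mu> (s 2) (\<mu> (s 1) (\<mu> (s 2) (\<mu> (s 3) (\<mu> (s 2) w))))))"
      if "w \<in> carrier ?F" for w
      unfolding v_def using s that
      by (simp only: is_mu_mult_apply[OF \<mu>] T.m_closed s1.hom_closed s2.hom_closed s3.hom_closed)
    \<comment> \<open>These are the values of the involution \<open>t_1\<close> from the
      introduction: \<open>x_3\<close> cancels in the conjugation and only \<open>x_4\<close>
      remains.\<close>
    have v_tab: "\<mu> v (free_gen 1) = free_gen 1 \<otimes>\<^bsub>?F\<^esub> (free_gen 2 \<otimes>\<^bsub>?F\<^esub> free_gen 4)"
      "\<mu> v (free_gen 2) =
        inv\<^bsub>?F\<^esub> free_gen 4 \<otimes>\<^bsub>?F\<^esub> (inv\<^bsub>?F\<^esub> free_gen 2 \<otimes>\<^bsub>?F\<^esub> inv\<^bsub>?F\<^esub> free_gen 4)"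
      "\<mu> v (free_gen 3) = free_gen 3"
      "\<mu> v (free_gen 4) = free_gen 4"
      using x by (simp_all add: v tab F.inv_mult_group F.m_assoc)
    have u_tab: "\<mu> u (free_gen 1) = free_gen 1 \<otimes>\<^bsub>?F\<^esub> free_gen 2"
      "\<mu> u (free_gen 2) = inv\<^bsub>?F\<^esub> free_gen 2"
      "\<mu> u (free_gen 3) = free_gen 3 \<otimes>\<^bsub>?F\<^esub> free_gen 4"
      "\<mu> u (free_gen 4) = inv\<^bsub>?F\<^esub> free_gen 4"
      using x by (simp_all add: u tab)
    have uv_fixed: "\<mu> u (free_gen j) = free_gen j" "\<mu> v (free_gen j) = free_gen j" if "j > 4"
      using x(5) by (simp_all only: u v fixed[OF that])
    interpret u: group_hom ?F ?F "\<mu> u" by (rule is_mu_group_hom(2)[OF \<mu> uv(1)])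
    interpret v: group_hom ?F ?F "\<mu> v" by (rule is_mu_group_hom(2)[OF \<mu> uv(2)])
    \<comment> \<open>Both orders send \<open>x_1\<close> to \<open>x_1 x_4^-1\<close> and
      \<open>x_2\<close> to \<open>x_4 x_2 x_4\<close>. On \<open>x_3\<close> and \<open>x_4\<close>
      both act as \<open>u\<close>, since \<open>v\<close> fixes these two generators.\<close>
    have "\<mu> u (\<mu> v (free_gen j)) = \<mu> v (\<mu> u (free_gen j))"
    proof -
      consider "j = 1" | "j = 2" | "j = 3" | "j = 4" | "j > 4" using j by force
      then show ?thesis
        using x by cases (simp_all add: u_tab v_tab uv_fixed F.inv_mult_group F.m_assoc)
    qed
    then show "\<mu> (u \<otimes>\<^bsub>?T\<^esub> v) (free_gen j) = \<mu> (v \<otimes>\<^bsub>?T\<^esub> u) (free_gen j)"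
      using uv x by (simp only: is_mu_mult_apply[OF \<mu>])
  qed
  ultimately show False
    using inj_onD[OF inj] uv by (metis T.m_closed)
qed

theorem theorem7p1:
  fixes n :: nat
  assumes "n \<ge> 2"
  shows "(\<forall>i\<in>{1..n - 1}. \<exists>!\<alpha>. \<alpha> \<in> carrier (AutoGroup (free_group {1..n})) \<and>
            (\<forall>j\<in>{1..n}. \<alpha> (free_gen j) = mu_gen_image n i j)) \<and>
         (\<exists>!\<mu>. is_mu n \<mu>) \<and>
         (\<forall>\<mu>. is_mu n \<mu> \<longrightarrow>
            (inj_on \<mu> (carrier (twin_group n)) \<longleftrightarrow> n = 2 \<or> n = 3))"
proof (intro conjI ballI allI impI)
  show "\<exists>!\<alpha>. \<alpha> \<in> carrier (AutoGroup (free_group {1..n})) \<and>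
      (\<forall>j\<in>{1..n}. \<alpha> (free_gen j) = mu_gen_image n i j)" if "i \<in> {1..n - 1}" for i
    using that by (rule mu_gen_aut_unique_exists)
  show "\<exists>!\<mu>. is_mu n \<mu>" by (rule is_mu_unique_exists)
  show "inj_on \<mu> (carrier (twin_group n)) \<longleftrightarrow> n = 2 \<or> n = 3" if \<mu>: "is_mu n \<mu>" for \<mu>
  proof
    assume "inj_on \<mu> (carrier (twin_group n))"
    then have "\<not> n \<ge> 4" using mu_not_injective[OF \<mu>] by blast
    then show "n = 2 \<or> n = 3" using assms by linarith
  next
    assume "n = 2 \<or> n = 3"
    then show "inj_on \<mu> (carrier (twin_group n))"
      using mu_2_injective mu_3_injective \<mu> by blast
  qed
qed

end
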